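(* Let $X$ be a Hilbert space and let $T$ be a closed linear subspace of $X\times X$ which is Hermitian. Then: (i) $T$ is bounded from below (above) if and only if so is $T_s$, with the same lower (upper) bound; (ii) $T$ is non-negative (non-positive) if and only if so is $T_s$; (iii) $T$ is positive (negative) if and only if so is $T_s$.
   Context: For a linear subspace $T$ of $X\times X$, $D(T)$ is its domain. $T$ is Hermitian if $\langle y_2,x_1\rangle=\langle x_2,y_1\rangle$ for all $(x_1,y_1),(x_2,y_2)\in T$. Let $W$ be a Hermitian linear subspace of $X\times X$. $W$ is bounded from below (above) if there is $C\in\mathbf R$ with $\langle y,x\rangle\ge C\|x\|^2$ ($\langle y,x\rangle\le C\|x\|^2$) for all $(x,y)\in W$; such a $C$ is called a lower (upper) bound of $W$. $W$ is non-negative (non-positive) if $0$ is a lower (upper) bound of $W$. $W$ is positive (negative) if $\langle y,x\rangle>0$ ($\langle y,x\rangle<0$) for all $(x,y)\in W$ with $x\ne0$. $X\times X$ carries the inner product $\langle(x_1,y_1),(x_2,y_2)\rangle=\langle x_1,x_2\rangle+\langle y_1,y_2\rangle$. For $T$ closed, $T_\infty:=\{(0,g)\in X^2:(0,g)\in T\}$ and $T_s:=T\ominus T_\infty$ (the orthogonal complement of $T_\infty$ in $T$), which is (the graph of) a single-valued linear operator with domain $D(T)$. (As a subspace of $T$, $T_s$ is Hermitian when $T$ is.) *)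

theory Defs
  imports "HOL-Analysis.Analysis" "HOL-Library.Complex_Order"
begin

text \<open>
  A common abstraction of the real and the complex numbers, so that Hilbert spaces over both
  fields are covered at once (by Gelfand--Mazur there are no other instances up to isometric
  isomorphism). The order is the usual one on the reals; on the complex numbers \<open>z \<le> w\<close> means
  that \<open>w - z\<close> is a non-negative real number. Hence an inequality between scalars includes the
  claim that their difference is real.
\<close>

class real_or_complex = real_normed_field + order +
  fixes scnj :: "'a \<Rightarrow> 'a"
  assumes scnj_add: "scnj (x + y) = scnj x + scnj y"
    and scnj_mult: "scnj (x * y) = scnj x * scnj y"
    and scnj_scnj: "scnj (scnj x) = x"
    and mult_scnj: "x * scnj x = (norm x)\<^sup>2 *\<^sub>R 1"
    and less_eq_scalar_iff: "x \<le> y \<longleftrightarrow> (\<exists>r\<ge>0. y - x = r *\<^sub>R 1)"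

instantiation real :: real_or_complex
begin

definition scnj_real :: "real \<Rightarrow> real" where "scnj_real x = x"

instance
  by standard (auto simp: scnj_real_def power2_eq_square intro: exI[of _ "_ - _"])

end

instantiation complex :: real_or_complex
begin

definition scnj_complex :: "complex \<Rightarrow> complex" where "scnj_complex = cnj"

instance
proof
  fix x y :: complex
  show "x * scnj x = (norm x)\<^sup>2 *\<^sub>R 1"
    by (simp add: scnj_complex_def scaleR_conv_of_real flip: complex_norm_square)
  show "x \<le> y \<longleftrightarrow> (\<exists>r\<ge>0. y - x = r *\<^sub>R 1)"
    by (auto simp: less_eq_complex_def complex_eq_iff intro: exI[of _ "Re y - Re x"])
qed (simp_all add: scnj_complex_def)

end

text \<open>
  The inner product is linear in the first argument. Positive definiteness is contained in
  \<open>ip_self\<close>, since \<^term>\<open>norm\<close> is a norm; completeness is part of the class \<^class>\<open>banach\<close>.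
\<close>

locale hilbert_space = vector_space smul
  for smul :: "'k::real_or_complex \<Rightarrow> 'a::banach \<Rightarrow> 'a" +
  fixes ip :: "'a \<Rightarrow> 'a \<Rightarrow> 'k"
  assumes smul_of_real: "smul (of_real r) x = r *\<^sub>R x"
    and ip_commute: "ip x y = scnj (ip y x)"
    and ip_add_left: "ip (x + y) z = ip x z + ip y z"
    and ip_smul_left: "ip (smul c x) y = c * ip x y"
    and ip_self: "ip x x = of_real ((norm x)\<^sup>2)"

lemma hilbert_space_real:
  "hilbert_space scaleR (inner :: 'a::{real_inner,banach} \<Rightarrow> 'a \<Rightarrow> real)"
  by unfold_locales
    (auto simp: algebra_simps inner_commute scnj_real_def inner_add_left power2_norm_eq_inner)

lemma hilbert_space_complex: "hilbert_space (*) (\<lambda>x y :: complex. x * cnj y)"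
  by unfold_locales
    (auto simp: algebra_simps scnj_complex_def scaleR_conv_of_real simp flip: complex_norm_square)

abbreviation pair_smul :: "('k::real_or_complex \<Rightarrow> 'a::banach \<Rightarrow> 'a) \<Rightarrow> 'k \<Rightarrow> 'a \<times> 'a \<Rightarrow> 'a \<times> 'a"
  where "pair_smul smul \<equiv> module_prod.scale smul smul"

definition pair_ip :: "('a \<Rightarrow> 'a \<Rightarrow> 'k::real_or_complex) \<Rightarrow> 'a \<times> 'a \<Rightarrow> 'a \<times> 'a \<Rightarrow> 'k"
  where "pair_ip ip p q = ip (fst p) (fst q) + ip (snd p) (snd q)"

text \<open>
  The library's norm on the product type is the one induced by \<^const>\<open>pair_ip\<close>, so
  \<^const>\<open>closed\<close> refers to the Hilbert space topology of the product.
\<close>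

lemma hilbert_space_pair:
  fixes smul :: "'k::real_or_complex \<Rightarrow> 'a::banach \<Rightarrow> 'a"
  assumes "hilbert_space smul ip"
  shows "hilbert_space (pair_smul smul) (pair_ip ip)"
proof -
  interpret hilbert_space smul ip by fact
  interpret P: vector_space_prod smul smul ..
  show ?thesis
  proof
    fix x y z :: "'a \<times> 'a" and c r
    show "P.scale (of_real r) x = r *\<^sub>R x"
      by (simp add: P.scale_def smul_of_real scaleR_prod_def)
    show "pair_ip ip x y = scnj (pair_ip ip y x)"
      by (simp add: pair_ip_def scnj_add flip: ip_commute)
    show "pair_ip ip (x + y) z = pair_ip ip x z + pair_ip ip y z"
      by (simp add: pair_ip_def ip_add_left)
    show "pair_ip ip (P.scale c x) y = c * pair_ip ip x y"
      by (simp add: pair_ip_def P.scale_def ip_smul_left algebra_simps)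
    show "pair_ip ip x x = of_real ((norm x)\<^sup>2)"
      by (simp add: pair_ip_def ip_self norm_prod_def)
  qed
qed

definition hermitian :: "('a \<Rightarrow> 'a \<Rightarrow> 'k) \<Rightarrow> ('a \<times> 'a) set \<Rightarrow> bool"
  where "hermitian ip T \<longleftrightarrow> (\<forall>(x1, y1)\<in>T. \<forall>(x2, y2)\<in>T. ip y2 x1 = ip x2 y1)"

definition lower_bound ::
    "('a::banach \<Rightarrow> 'a \<Rightarrow> 'k::real_or_complex) \<Rightarrow> real \<Rightarrow> ('a \<times> 'a) set \<Rightarrow> bool"
  where "lower_bound ip C W \<longleftrightarrow> (\<forall>(x, y)\<in>W. ip y x \<ge> of_real (C * (norm x)\<^sup>2))"

definition upper_bound ::
    "('a::banach \<Rightarrow> 'a \<Rightarrow> 'k::real_or_complex) \<Rightarrow> real \<Rightarrow> ('a \<times> 'a) set \<Rightarrow> bool"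
  where "upper_bound ip C W \<longleftrightarrow> (\<forall>(x, y)\<in>W. ip y x \<le> of_real (C * (norm x)\<^sup>2))"

definition bounded_from_below where "bounded_from_below ip W \<longleftrightarrow> (\<exists>C. lower_bound ip C W)"

definition bounded_from_above where "bounded_from_above ip W \<longleftrightarrow> (\<exists>C. upper_bound ip C W)"

definition non_negative where "non_negative ip W \<longleftrightarrow> lower_bound ip 0 W"

definition non_positive where "non_positive ip W \<longleftrightarrow> upper_bound ip 0 W"

definition positive ::
    "('a::banach \<Rightarrow> 'a \<Rightarrow> 'k::real_or_complex) \<Rightarrow> ('a \<times> 'a) set \<Rightarrow> bool"
  where "positive ip W \<longleftrightarrow> (\<forall>(x, y)\<in>W. x \<noteq> 0 \<longrightarrow> ip y x > 0)"

definition negative ::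
    "('a::banach \<Rightarrow> 'a \<Rightarrow> 'k::real_or_complex) \<Rightarrow> ('a \<times> 'a) set \<Rightarrow> bool"
  where "negative ip W \<longleftrightarrow> (\<forall>(x, y)\<in>W. x \<noteq> 0 \<longrightarrow> ip y x < 0)"

definition multivalued_part :: "('a::banach \<times> 'a) set \<Rightarrow> ('a \<times> 'a) set"
  where "multivalued_part T = {(0, g) | g. (0, g) \<in> T}"

definition operator_part ::
    "('a::banach \<Rightarrow> 'a \<Rightarrow> 'k::real_or_complex) \<Rightarrow> ('a \<times> 'a) set \<Rightarrow> ('a \<times> 'a) set"
  where "operator_part ip T = {p \<in> T. \<forall>q\<in>multivalued_part T. pair_ip ip p q = 0}"

text \<open>
  The notions of boundedness and sign above are meant for Hermitian linear subspaces; the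
  operator part is again one.
\<close>

lemma hermitian_operator_part: "hermitian ip T \<Longrightarrow> hermitian ip (operator_part ip T)"
  by (auto simp: hermitian_def operator_part_def)

lemma subspace_operator_part:
  assumes "hilbert_space smul ip" "module.subspace (pair_smul smul) T"
  shows "module.subspace (pair_smul smul) (operator_part ip T)"
proof -
  interpret H: hilbert_space "pair_smul smul" "pair_ip ip"
    using assms(1) by (rule hilbert_space_pair)
  have "pair_ip ip 0 q = 0" for q
    using H.ip_add_left[of 0 0 q] by simp
  then show ?thesis
    using assms(2)
    by (auto simp: H.subspace_def operator_part_def H.ip_add_left H.ip_smul_left)
qed

end

theory Submission
  imports Defs
begin

text \<open>
  All the notions involved are conditions on the pairs \<open>(x, \<langle>y, x\<rangle>)\<close> with \<open>(x, y) \<in> T\<close>, and passing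
  to the operator part does not change the set of these pairs. Indeed, let \<open>(x, y) \<in> T\<close> and let
  \<open>g\<close> be the orthogonal projection of \<open>y\<close> onto the closed subspace \<open>{h. (0, h) \<in> T}\<close>. Then
  \<open>(x, y - g) \<in> T\<close> is orthogonal to the multivalued part, hence lies in the operator part
  (\<open>operator_part_same_domain\<close>). Since \<open>T\<close> is Hermitian, comparing \<open>(x, y)\<close> with \<open>(0, g)\<close> gives
  \<open>\<langle>g, x\<rangle> = \<langle>0, y\<rangle> = 0\<close>, so that \<open>\<langle>y - g, x\<rangle> = \<langle>y, x\<rangle>\<close> (\<open>ball_operator_part_iff\<close>).

  The analytic ingredient is the projection theorem (\<open>orthogonal_projection_exists\<close>), the only
  place where closedness of \<open>T\<close> and completeness of the space enter. It is obtained by the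
  classical minimisation of the distance.
\<close>

lemma scnj_of_real: "scnj (of_real r :: 'k::real_or_complex) = of_real r"
proof (cases "r = 0")
  case True
  have "scnj (0 :: 'k) + scnj 0 = scnj 0"
    by (simp flip: scnj_add)
  then show ?thesis
    using True by simp
next
  case False
  have "of_real r * scnj (of_real r :: 'k) = of_real r * of_real r"
    by (simp add: mult_scnj power2_eq_square scaleR_conv_of_real)
  then show ?thesis
    using False by simp
qed

context hilbert_space
begin

lemma ip_zero_left [simp]: "ip 0 y = 0"
  using ip_add_left[of 0 0 y] by simp

lemma ip_minus_left: "ip (- x) y = - ip x y"
  using ip_add_left[of x "- x" y] by (simp add: eq_neg_iff_add_eq_0 add.commute)

lemma ip_diff_left: "ip (x - y) z = ip x z - ip y z"
  using ip_add_left[of x "- y" z] by (simp add: ip_minus_left)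

lemma ip_add_right: "ip z (x + y) = ip z x + ip z y"
  by (metis ip_commute ip_add_left scnj_add)

lemma ip_zero_right [simp]: "ip y 0 = 0"
  using ip_add_right[of y 0 0] by simp

lemma ip_diff_right: "ip z (x - y) = ip z x - ip z y"
  using ip_add_right[of z "x - y" y] by simp

lemma ip_smul_right: "ip x (smul c y) = scnj c * ip x y"
  by (metis ip_commute ip_smul_left scnj_mult)

lemma parallelogram_law:
  fixes x y :: 'a
  shows "(norm (x + y))\<^sup>2 + (norm (x - y))\<^sup>2 = 2 * (norm x)\<^sup>2 + 2 * (norm y)\<^sup>2"
proof -
  have "ip (x + y) (x + y) + ip (x - y) (x - y) = 2 * ip x x + 2 * ip y y"
    by (simp add: ip_add_left ip_add_right ip_diff_left ip_diff_right)
  then have "(of_real ((norm (x + y))\<^sup>2 + (norm (x - y))\<^sup>2) :: 'k)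
      = of_real (2 * (norm x)\<^sup>2 + 2 * (norm y)\<^sup>2)"
    by (simp add: ip_self)
  then show ?thesis
    by (simp only: of_real_eq_iff)
qed

text \<open>
  For \<open>h \<noteq> 0\<close>, the value \<open>c = \<langle>z, h\<rangle> / \<parallel>h\<parallel>\<^sup>2\<close> minimises \<open>\<parallel>z - c h\<parallel>\<close> and gives
  \<open>\<parallel>z - c h\<parallel>\<^sup>2 = \<parallel>z\<parallel>\<^sup>2 - \<bar>\<langle>z, h\<rangle>\<bar>\<^sup>2 / \<parallel>h\<parallel>\<^sup>2\<close>,
  which is less than \<open>\<parallel>z\<parallel>\<^sup>2\<close> unless \<open>\<langle>z, h\<rangle> = 0\<close>.
\<close>

lemma orthogonal_if_norm_minimal:
  assumes min: "\<And>c. norm z \<le> norm (z - smul c h)"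
  shows "ip z h = 0"
proof (cases "h = 0")
  case False
  define n where "n = (norm h)\<^sup>2"
  define t :: 'k where "t = of_real (inverse n)"
  define c where "c = ip z h * t"
  have n: "n > 0"
    using False by (simp add: n_def)
  have scnj_c: "scnj c = ip h z * t"
    by (simp only: c_def t_def scnj_mult scnj_of_real flip: ip_commute)
  have mult: "ip z h * ip h z = of_real ((norm (ip z h))\<^sup>2)"
    using mult_scnj[of "ip z h"] by (simp only: scaleR_conv_of_real mult_1_right flip: ip_commute)
  have "ip h h * t = of_real (n * inverse n)"
    by (simp only: ip_self t_def of_real_mult flip: n_def)
  then have hh: "ip h h * t = 1"
    using n by simp
  have "ip (z - smul c h) (z - smul c h)
      = ip z z - c * ip h z - scnj c * ip z h + c * scnj c * ip h h"
    by (simp add: ip_diff_left ip_diff_right ip_smul_left ip_smul_right algebra_simps)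
  also have "\<dots> = ip z z - ip z h * ip h z * t * (2 - ip h h * t)"
    unfolding scnj_c unfolding c_def by (simp add: algebra_simps)
  also have "\<dots> = ip z z - ip z h * ip h z * t"
    by (simp only: hh) simp
  finally have "(of_real ((norm (z - smul c h))\<^sup>2) :: 'k)
      = of_real ((norm z)\<^sup>2 - (norm (ip z h))\<^sup>2 * inverse n)"
    by (simp only: mult ip_self t_def of_real_diff of_real_mult)
  then have "(norm (z - smul c h))\<^sup>2 = (norm z)\<^sup>2 - (norm (ip z h))\<^sup>2 * inverse n"
    by (simp only: of_real_eq_iff)
  moreover have "(norm z)\<^sup>2 \<le> (norm (z - smul c h))\<^sup>2"
    using min[of c] by (simp add: power_mono)
  ultimately have "(norm (ip z h))\<^sup>2 * inverse n \<le> 0"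
    by linarith
  then show ?thesis
    using n by (simp add: mult_le_0_iff)
qed simp

text \<open>
  A minimising sequence is Cauchy: midpoints of its members stay in \<open>M\<close>, hence are no closer
  to \<open>y\<close> than the infimum, and the parallelogram law turns this into a bound on the distance of
  the members from each other.
\<close>

lemma closest_point_exists:
  assumes M: "subspace M" and "closed M"
  shows "\<exists>g\<in>M. \<forall>h\<in>M. norm (y - g) \<le> norm (y - h)"
proof -
  define D where "D = (INF h\<in>M. (norm (y - h))\<^sup>2)"
  have bdd: "bdd_below ((\<lambda>h. (norm (y - h))\<^sup>2) ` M)"
    by (rule bdd_belowI2[of _ 0]) simp
  have D_le: "D \<le> (norm (y - h))\<^sup>2" if "h \<in> M" for h
    unfolding D_def by (rule cINF_lower[OF bdd that])
  have "M \<noteq> {}"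
    using subspace_0[OF M] by blast
  have "\<exists>h\<in>M. (norm (y - h))\<^sup>2 < D + inverse (Suc n)" for n
    using cINF_less_iff[OF \<open>M \<noteq> {}\<close> bdd, of "D + inverse (Suc n)"]
    by (simp flip: D_def)
  then obtain s where s: "\<And>n. s n \<in> M" and s_less: "\<And>n. (norm (y - s n))\<^sup>2 < D + inverse (Suc n)"
    by metis
  have dist_less: "(norm (s m - s n))\<^sup>2 < 2 * inverse (Suc m) + 2 * inverse (Suc n)" for m n
  proof -
    define h where "h = smul (of_real (1/2)) (s m + s n)"
    have "h \<in> M"
      unfolding h_def using s M by (intro subspace_scale subspace_add)
    have "(y - s m) + (y - s n) = 2 *\<^sub>R (y - h)"
      by (simp only: h_def smul_of_real) (simp add: algebra_simps scaleR_2)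
    then have sum: "(norm ((y - s m) + (y - s n)))\<^sup>2 = 4 * (norm (y - h))\<^sup>2"
      by (simp add: power_mult_distrib)
    have diff: "norm ((y - s m) - (y - s n)) = norm (s m - s n)"
      by (simp add: norm_minus_commute)
    show ?thesis
      using parallelogram_law[of "y - s m" "y - s n"] D_le[OF \<open>h \<in> M\<close>] s_less[of m] s_less[of n]
      unfolding sum diff by linarith
  qed
  have "Cauchy s"
  proof (rule metric_CauchyI)
    fix e :: real
    assume "0 < e"
    then obtain N where N: "inverse (real (Suc N)) < e\<^sup>2 / 4"
      using reals_Archimedean[of "e\<^sup>2 / 4"] by auto
    have "dist (s m) (s n) < e" if "m \<ge> N" "n \<ge> N" for m n
    proof -
      have le: "inverse (real (Suc k)) \<le> inverse (real (Suc N))" if "k \<ge> N" for k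
        using that by (intro le_imp_inverse_le) auto
      have "(norm (s m - s n))\<^sup>2 < e\<^sup>2"
        using dist_less[of m n] N le[OF \<open>m \<ge> N\<close>] le[OF \<open>n \<ge> N\<close>] by linarith
      then show ?thesis
        using \<open>0 < e\<close> by (simp add: dist_norm power_less_imp_less_base)
    qed
    then show "\<exists>N. \<forall>m\<ge>N. \<forall>n\<ge>N. dist (s m) (s n) < e"
      by blast
  qed
  then obtain g where lim: "s \<longlonglongrightarrow> g"
    using Cauchy_convergent convergent_def by blast
  have "g \<in> M"
    using \<open>closed M\<close> s lim by (rule closed_sequentially)
  have "(\<lambda>n. (norm (y - s n))\<^sup>2) \<longlonglongrightarrow> (norm (y - g))\<^sup>2"
    by (intro tendsto_intros lim)
  moreover have "(\<lambda>n. D + inverse (real (Suc n))) \<longlonglongrightarrow> D + 0"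
    by (intro tendsto_intros LIMSEQ_inverse_real_of_nat)
  ultimately have le_D: "(norm (y - g))\<^sup>2 \<le> D"
    using s_less by (auto intro: LIMSEQ_le less_imp_le)
  have "norm (y - g) \<le> norm (y - h)" if "h \<in> M" for h
    by (rule power2_le_imp_le[OF order_trans[OF le_D D_le[OF that]] norm_ge_zero])
  then show ?thesis
    using \<open>g \<in> M\<close> by blast
qed

lemma orthogonal_projection_exists:
  assumes M: "subspace M" and "closed M"
  shows "\<exists>g\<in>M. \<forall>h\<in>M. ip (y - g) h = 0"
proof -
  obtain g where g: "g \<in> M" and min: "\<And>h. h \<in> M \<Longrightarrow> norm (y - g) \<le> norm (y - h)"
    using closest_point_exists[OF assms] by blast
  have "ip (y - g) h = 0" if "h \<in> M" for h
  proof (rule orthogonal_if_norm_minimal)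
    fix c
    have "g + smul c h \<in> M"
      using M g that by (intro subspace_add subspace_scale)
    from min[OF this] show "norm (y - g) \<le> norm (y - g - smul c h)"
      by (simp add: diff_diff_eq)
  qed
  then show ?thesis
    using g by blast
qed

text \<open>
  Orthogonality to \<open>(0, h)\<close> in the product only concerns second components, so it suffices to
  project \<open>y\<close> within the space itself.
\<close>

lemma operator_part_same_domain:
  assumes T: "module.subspace (pair_smul smul) T" and "closed T" and xy: "(x, y) \<in> T"
  shows "\<exists>g. (0, g) \<in> T \<and> (x, y - g) \<in> operator_part ip T"
proof -
  interpret P: vector_space_prod smul smul ..
  define M where "M = {g. (0, g) \<in> T}"
  have "subspace M"
  proof (rule subspaceI)
    show "0 \<in> M"
      using P.p.subspace_0[OF T] by (simp add: M_def zero_prod_def)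
    show "g + h \<in> M" if "g \<in> M" "h \<in> M" for g h
      using P.p.subspace_add[OF T, of "(0, g)" "(0, h)"] that by (simp add: M_def)
    show "smul c g \<in> M" if "g \<in> M" for c g
      using P.p.subspace_scale[OF T, of "(0, g)" c] that by (simp add: M_def P.scale_def)
  qed
  moreover have "closed M"
  proof -
    have "closed (Pair 0 -` T)"
      using \<open>closed T\<close> by (intro closed_vimage continuous_intros)
    then show ?thesis
      by (simp add: M_def vimage_def)
  qed
  ultimately obtain g where g: "g \<in> M" and orth: "\<And>h. h \<in> M \<Longrightarrow> ip (y - g) h = 0"
    using orthogonal_projection_exists by blast
  have "(x, y - g) \<in> T"
    using P.p.subspace_diff[OF T xy, of "(0, g)"] g by (simp add: M_def)
  then have "(x, y - g) \<in> operator_part ip T"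
    using orth by (auto simp: operator_part_def multivalued_part_def pair_ip_def M_def)
  then show ?thesis
    using g by (auto simp: M_def)
qed

text \<open>
  Every notion of boundedness or sign is an instance of this equivalence for a suitable \<open>P\<close>.
\<close>

lemma ball_operator_part_iff:
  assumes T: "module.subspace (pair_smul smul) T" "closed T" and herm: "hermitian ip T"
  shows "(\<forall>(x, y)\<in>T. P x (ip y x)) \<longleftrightarrow> (\<forall>(x, y)\<in>operator_part ip T. P x (ip y x))"
proof
  assume R: "\<forall>(x, y)\<in>operator_part ip T. P x (ip y x)"
  show "\<forall>(x, y)\<in>T. P x (ip y x)"
  proof (intro ballI, clarify)
    fix x y
    assume xy: "(x, y) \<in> T"
    obtain g where g: "(0, g) \<in> T" and op: "(x, y - g) \<in> operator_part ip T"
      using operator_part_same_domain[OF T xy] by blast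
    have "ip g x = ip 0 y"
      using bspec[OF bspec[OF herm[unfolded hermitian_def] xy, unfolded prod.case] g] by simp
    then have "ip (y - g) x = ip y x"
      by (simp add: ip_diff_left)
    then show "P x (ip y x)"
      using R op by auto
  qed
qed (auto simp: operator_part_def)

end

theorem theorem3p4:
  fixes smul :: "'k::real_or_complex \<Rightarrow> 'a::banach \<Rightarrow> 'a"
    and ip :: "'a \<Rightarrow> 'a \<Rightarrow> 'k"
    and T :: "('a \<times> 'a) set"
  assumes "hilbert_space smul ip"
    and "module.subspace (pair_smul smul) T"
    and "closed T"
    and "hermitian ip T"
  shows "(bounded_from_below ip T \<longleftrightarrow> bounded_from_below ip (operator_part ip T))
      \<and> (\<forall>C. lower_bound ip C T \<longleftrightarrow> lower_bound ip C (operator_part ip T))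
      \<and> (bounded_from_above ip T \<longleftrightarrow> bounded_from_above ip (operator_part ip T))
      \<and> (\<forall>C. upper_bound ip C T \<longleftrightarrow> upper_bound ip C (operator_part ip T))
      \<and> (non_negative ip T \<longleftrightarrow> non_negative ip (operator_part ip T))
      \<and> (non_positive ip T \<longleftrightarrow> non_positive ip (operator_part ip T))
      \<and> (positive ip T \<longleftrightarrow> positive ip (operator_part ip T))
      \<and> (negative ip T \<longleftrightarrow> negative ip (operator_part ip T))"
proof -
  interpret hilbert_space smul ip by fact
  note iff = ball_operator_part_iff[OF assms(2-4)]
  have lower: "lower_bound ip C T \<longleftrightarrow> lower_bound ip C (operator_part ip T)" for C
    unfolding lower_bound_def by (rule iff)
  have upper: "upper_bound ip C T \<longleftrightarrow> upper_bound ip C (operator_part ip T)" for C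
    unfolding upper_bound_def by (rule iff)
  have pos: "positive ip T \<longleftrightarrow> positive ip (operator_part ip T)"
    unfolding positive_def by (rule iff)
  have neg: "negative ip T \<longleftrightarrow> negative ip (operator_part ip T)"
    unfolding negative_def by (rule iff)
  show ?thesis
    using lower upper pos neg
    by (simp add: bounded_from_below_def bounded_from_above_def non_negative_def non_positive_def)
qed

end
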